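(* Let $B$ be the unit ball of $\mathbb{R}^3$ and let $h_0\in C^1(\overline{B})$ be a radial function satisfying $$h_0(x)+\tfrac12\langle x,\nabla h_0(x)\rangle\ge 0\qquad\text{for all }x\in B.$$ Then for every $p>3$ there exists $\delta>0$, depending only on $h_0$ and $p$, such that if $h\in C^{0,\eta}(B)$ for some $\eta>0$ and $\|h-h_0\|_{L^p(B)}\le\delta$, then there exists no positive radial solution $u$ of $$\Delta u+hu=u^5\ \text{ in }B,\qquad u=0\ \text{ on }\partial B.$$
   Context: The Laplacian is taken with the sign convention $\Delta u=-\sum_{i=1}^3\partial^2u/\partial x_i^2$. The space $C^{0,\eta}(B)$ is the space of bounded uniformly $\eta$-Hölder continuous functions on $B$, with $\eta\in(0,1]$. A solution is a function $u\in C^2(B)\cap C^0(\overline{B})$ satisfying the equation in $B$ and the boundary condition; positive means $u>0$ in $B$. A function on $B$ is radial if it depends only on $|x|$. *)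

theory Defs
  imports "HOL-Analysis.Analysis"
begin

(* Unspecified where f is not differentiable; below it is only used for functions whose
   differentiability is required by C1_on or C2_on. *)
definition partial_deriv :: "'a::euclidean_space \<Rightarrow> ('a \<Rightarrow> real) \<Rightarrow> 'a \<Rightarrow> real"
  where "partial_deriv b f x = frechet_derivative f (at x) b"

definition gradient :: "('a::euclidean_space \<Rightarrow> real) \<Rightarrow> 'a \<Rightarrow> 'a"
  where "gradient f x = (\<Sum>b\<in>Basis. partial_deriv b f x *\<^sub>R b)"

lemma partial_deriv_eq:
  assumes "(f has_derivative f') (at x)"
  shows "partial_deriv b f x = f' b"
  using frechet_derivative_at[OF assms] by (simp add: partial_deriv_def)

lemma gradient_eq:
  assumes "GDERIV f x :> D"
  shows "gradient f x = D"
  using assms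
  by (simp add: gradient_def gderiv_def partial_deriv_eq inner_commute[of _ D] euclidean_representation)

definition C1_on :: "'a::euclidean_space set \<Rightarrow> ('a \<Rightarrow> real) \<Rightarrow> bool"
  where "C1_on S f \<longleftrightarrow>
    (\<forall>x\<in>S. f differentiable (at x)) \<and> (\<forall>b\<in>Basis. continuous_on S (partial_deriv b f))"

definition C2_on :: "'a::euclidean_space set \<Rightarrow> ('a \<Rightarrow> real) \<Rightarrow> bool"
  where "C2_on S f \<longleftrightarrow> C1_on S f \<and> (\<forall>b\<in>Basis. C1_on S (partial_deriv b f))"

(* The space C^1 of the closure of an open set S: f and its first derivatives, which are
   only considered in S, extend continuously to the closure. *)
definition C1_on_closure :: "'a::euclidean_space set \<Rightarrow> ('a \<Rightarrow> real) \<Rightarrow> bool"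
  where "C1_on_closure S f \<longleftrightarrow>
    C1_on S f \<and> continuous_on (closure S) f \<and>
    (\<forall>b\<in>Basis. \<exists>g. continuous_on (closure S) g \<and> (\<forall>x\<in>S. g x = partial_deriv b f x))"

(* Geometer's sign convention: this operator is nonnegative. *)
definition laplacian :: "('a::euclidean_space \<Rightarrow> real) \<Rightarrow> 'a \<Rightarrow> real"
  where "laplacian f x = - (\<Sum>b\<in>Basis. partial_deriv b (partial_deriv b f) x)"

definition radial_on :: "'a::real_normed_vector set \<Rightarrow> ('a \<Rightarrow> real) \<Rightarrow> bool"
  where "radial_on S f \<longleftrightarrow> (\<forall>x\<in>S. \<forall>y\<in>S. norm x = norm y \<longrightarrow> f x = f y)"

definition holder_on :: "real \<Rightarrow> 'a::metric_space set \<Rightarrow> ('a \<Rightarrow> real) \<Rightarrow> bool"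
  where "holder_on \<eta> S f \<longleftrightarrow>
    bounded (f ` S) \<and> (\<exists>C. \<forall>x\<in>S. \<forall>y\<in>S. \<bar>f x - f y\<bar> \<le> C * dist x y powr \<eta>)"

(* Only meaningful if the integrand is integrable over S, since otherwise the integral is 0.
   This holds for instance if f is bounded and continuous on a bounded open set S. *)
definition Lp_norm_on :: "real \<Rightarrow> 'a::euclidean_space set \<Rightarrow> ('a \<Rightarrow> real) \<Rightarrow> real"
  where "Lp_norm_on p S f = (LINT x:S|lborel. \<bar>f x\<bar> powr p) powr (1 / p)"

abbreviation B :: "(real^3) set"
  where "B \<equiv> ball 0 1"

definition positive_radial_solution :: "(real^3 \<Rightarrow> real) \<Rightarrow> (real^3 \<Rightarrow> real) \<Rightarrow> bool"
  where "positive_radial_solution h u \<longleftrightarrow>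
    C2_on B u \<and> continuous_on (closure B) u \<and>
    (\<forall>x\<in>B. laplacian u x + h x * u x = u x ^ 5) \<and>
    (\<forall>x\<in>frontier B. u x = 0) \<and>
    (\<forall>x\<in>B. u x > 0) \<and> radial_on B u"

end

theory Submission
  imports Defs
begin

text \<open>
  With f = r u and K = h - h0 a positive radial solution satisfies
  f'' = (h0 + K) f - f^5 / r^4 on (0,1), f(0) = f(1) = 0. The Pohozaev identity bounds f'(1)^2
  by the integral of |K| |2 r f f' - f^2|, because h0 + <x, grad h0> / 2 is nonnegative. Since
  the nonlinear term has a favourable sign, a Gronwall argument running backwards from r = 1
  gives f \<le> C |f'(1)| and then r |f'| \<le> C |f'(1)|, with C depending only on the
  integral of |h0 + K| over (0,1). So f'(1) = 0, and hence f = 0, once the integral of |K| over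
  (0,1) is small; for p > 3 this integral is controlled by the norm of K in L^p of the ball. To
  avoid regularity questions at the boundary, f'(1) is replaced by f(b) + |f'(b)| with b < 1,
  and b tends to 1 only at the end.
\<close>

section \<open>The radial equation\<close>

text \<open>The fundamental theorem for the gauge integral makes \<open>d\<close> integrable by
  itself, so only the majorant \<open>\<psi>\<close> has to be continuous. Every differential
  inequality below is integrated in this form.\<close>

lemma diff_le_integral_of_deriv_le:
  fixes \<phi> d \<psi> :: "real \<Rightarrow> real"
  assumes "a \<le> b"
    and "\<And>x. x \<in> {a..b} \<Longrightarrow> (\<phi> has_real_derivative d x) (at x within {a..b})"
    and "\<And>x. x \<in> {a..b} \<Longrightarrow> d x \<le> \<psi> x"
    and "continuous_on {a..b} \<psi>"
  shows "\<phi> b - \<phi> a \<le> integral {a..b} \<psi>"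
proof -
  have "(d has_integral (\<phi> b - \<phi> a)) {a..b}"
    using assms(1,2) by (intro fundamental_theorem_of_calculus)
      (auto simp: has_real_derivative_iff_has_vector_derivative)
  moreover have "(\<psi> has_integral integral {a..b} \<psi>) {a..b}"
    using assms(4) by (intro integrable_integral integrable_continuous_interval)
  ultimately show ?thesis
    using assms(3) by (rule has_integral_le)
qed

text \<open>Multiplying \<open>-(A + integral {r..b} (\<lambda>s. S s * f s))\<close> by the
  integrating factor \<open>exp (I r)\<close> gives a function that \<open>le\<close> forces to be
  nonincreasing in \<open>r\<close>; its values at \<open>a\<close> and \<open>b\<close> are then
  compared.\<close>

lemma backward_gronwall:
  fixes f S :: "real \<Rightarrow> real"
  assumes "a \<le> b" and S: "continuous_on {a..b} S" and f: "continuous_on {a..b} f"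
    and S0: "\<And>r. r \<in> {a..b} \<Longrightarrow> 0 \<le> S r"
    and le: "\<And>r. r \<in> {a..b} \<Longrightarrow> f r \<le> A + integral {r..b} (\<lambda>s. S s * f s)"
  shows "A + integral {a..b} (\<lambda>s. S s * f s) \<le> A * exp (integral {a..b} S)"
proof -
  define I where "I r = integral {a..r} S" for r
  define J where "J r = integral {a..r} (\<lambda>s. S s * f s)" for r
  define G where "G r = (J r - J b - A) * exp (I r)" for r
  have Sf: "continuous_on {a..b} (\<lambda>s. S s * f s)"
    using S f by (intro continuous_intros)
  have J: "integral {r..b} (\<lambda>s. S s * f s) = J b - J r" if "r \<in> {a..b}" for r
  proof -
    have "J r + integral {r..b} (\<lambda>s. S s * f s) = J b"
      unfolding J_def using that Sf
      by (intro Henstock_Kurzweil_Integration.integral_combine integrable_continuous_interval) auto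
    then show ?thesis by simp
  qed
  have "G b - G a \<le> integral {a..b} (\<lambda>r. 0)"
  proof (rule diff_le_integral_of_deriv_le[OF \<open>a \<le> b\<close>, where d = "\<lambda>r. S r * (f r - (A + (J b - J r))) * exp (I r)"])
    fix r assume r: "r \<in> {a..b}"
    have "(I has_real_derivative S r) (at r within {a..b})"
      unfolding I_def using integral_has_real_derivative[OF S r] .
    moreover have "(J has_real_derivative S r * f r) (at r within {a..b})"
      unfolding J_def using integral_has_real_derivative[OF Sf r] .
    ultimately show "(G has_real_derivative S r * (f r - (A + (J b - J r))) * exp (I r)) (at r within {a..b})"
      unfolding G_def by (auto intro!: derivative_eq_intros simp: algebra_simps)
    show "S r * (f r - (A + (J b - J r))) * exp (I r) \<le> 0"
      using S0[OF r] le[OF r] J[OF r] by (simp add: mult_nonneg_nonpos mult_nonpos_nonneg)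
  qed simp
  then have "G b \<le> G a" by simp
  moreover have "G b = - (A * exp (I b))" and "G a = - (A + integral {a..b} (\<lambda>s. S s * f s))"
    using J[of a] \<open>a \<le> b\<close> by (simp_all add: G_def I_def J_def)
  ultimately show ?thesis by (simp add: I_def)
qed

text \<open>
  The unknown f r = r u(r) solves f'' = (H0 + K) f - f^5 / r^4. Its Pohozaev functional is
  Q = r f'^2 + f^6 / (3 r^3) - f f' - H0 r f^2.
\<close>
lemma no_positive_profile:
  fixes f g H0 D K :: "real \<Rightarrow> real"
  assumes f': "\<And>r. 0 < r \<Longrightarrow> r < 1 \<Longrightarrow> (f has_real_derivative g r) (at r)"
    and g': "\<And>r. 0 < r \<Longrightarrow> r < 1 \<Longrightarrow>
      (g has_real_derivative (H0 r + K r) * f r - f r ^ 5 / r ^ 4) (at r)"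
    and H0': "\<And>r. 0 < r \<Longrightarrow> r < 1 \<Longrightarrow> (H0 has_real_derivative D r) (at r)"
    and mono: "\<And>r. 0 < r \<Longrightarrow> r < 1 \<Longrightarrow> 0 \<le> H0 r + 1 / 2 * (r * D r)"
    and f_pos: "\<And>r. 0 < r \<Longrightarrow> r < 1 \<Longrightarrow> 0 < f r"
    and H0_le: "\<And>r. 0 < r \<Longrightarrow> r < 1 \<Longrightarrow> \<bar>H0 r\<bar> \<le> m"
    and K: "continuous_on {0<..<1} K"
    and f1: "(f \<longlongrightarrow> 0) (at_left 1)"
    and f0: "((\<lambda>r. f r / r) \<longlongrightarrow> c) (at_right 0)"
    and g0: "(g \<longlongrightarrow> c) (at_right 0)"
    and small: "\<And>a b. 0 < a \<Longrightarrow> a \<le> b \<Longrightarrow> b < 1 \<Longrightarrow> integral {a..b} (\<lambda>r. \<bar>K r\<bar>) \<le> \<kappa>"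
    and "\<kappa> \<le> 1" and \<kappa>: "40 * exp (2 * (m + 1)) * \<kappa> \<le> 1"
  shows False
proof -
  define M where "M = m + 1"
  define S where "S r = \<bar>H0 r + K r\<bar>" for r
  define A where "A b = f b + \<bar>g b\<bar>" for b
  \<comment> \<open>With f = r u this is r^2 u'. Its derivative is r f'', so it can be bounded by
    integrating from 0, where it vanishes.\<close>
  define P where "P r = r * g r - f r" for r
  define Q where "Q r = r * (g r)\<^sup>2 + f r ^ 6 / (3 * r ^ 3) - f r * g r - H0 r * r * (f r)\<^sup>2" for r
  have m0: "0 \<le> m" using H0_le[of "1/2"] by simp
  have cf: "continuous_on {0<..<1} f" and cH: "continuous_on {0<..<1} H0"
    using f' H0' by (auto intro!: DERIV_isCont continuous_at_imp_continuous_on)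
  have cS: "continuous_on {0<..<1} S"
    unfolding S_def using cH K by (intro continuous_intros)
  have cSf: "continuous_on {0<..<1} (\<lambda>s. S s * f s)"
    using cS cf by (intro continuous_intros)
  have sub: "continuous_on {a..b} F" if "continuous_on {0<..<1} F" "0 < a" "b < 1" for a b and F :: "real \<Rightarrow> real"
    using that by (auto intro: continuous_on_subset)
  have S_le: "integral {a..b} S \<le> M" if "0 < a" "a \<le> b" "b < 1" for a b
  proof -
    have "integral {a..b} S \<le> integral {a..b} (\<lambda>r. m + \<bar>K r\<bar>)"
      using that H0_le cS cH K unfolding S_def
      by (intro integral_le integrable_continuous_interval continuous_intros sub)
        (auto intro!: order_trans[OF abs_triangle_ineq] add_mono)
    also have "\<dots> = m * (b - a) + integral {a..b} (\<lambda>r. \<bar>K r\<bar>)"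
      using that K by (subst Henstock_Kurzweil_Integration.integral_add)
        (auto intro!: integrable_continuous_interval continuous_intros sub)
    also have "\<dots> \<le> m * 1 + 1"
      using that small[of a b] \<open>\<kappa> \<le> 1\<close> m0 by (intro add_mono mult_left_mono) auto
    finally show ?thesis by (simp add: M_def)
  qed
  \<comment> \<open>The nonlinear term has the right sign to be dropped from an upper bound on f'',
    which leaves a linear inequality.\<close>
  have g'_le: "(H0 r + K r) * f r - f r ^ 5 / r ^ 4 \<le> S r * f r" if "0 < r" "r < 1" for r
  proof -
    have "(H0 r + K r) * f r \<le> S r * f r"
      using f_pos[OF that] unfolding S_def by (intro mult_right_mono) auto
    moreover have "0 \<le> f r ^ 5 / r ^ 4" using f_pos[OF that] by simp
    ultimately show ?thesis by linarith
  qed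
  \<comment> \<open>Two backward integrations from the data at \<open>b\<close> feed
    \<open>backward_gronwall\<close>. Only a lower bound for \<open>g\<close> results, since the
    dropped term allows no matching lower bound on \<open>g'\<close>; the upper bound for r g comes
    from \<open>P\<close> instead.\<close>
  have bnd: "f r \<le> A b * exp M" "- (A b * exp M) \<le> g r" "integral {r..b} (\<lambda>s. S s * f s) \<le> A b * exp M"
    if rb: "0 < r" "r \<le> b" "b < 1" for r b
  proof -
    let ?\<Phi> = "\<lambda>r. integral {r..b} (\<lambda>s. S s * f s)"
    have A0: "0 \<le> A b" using f_pos[of b] rb by (simp add: A_def)
    have g_ge: "g b - ?\<Phi> s \<le> g s" if "0 < s" "s \<le> b" for s
    proof -
      have "g b - g s \<le> ?\<Phi> s"
        using that rb g'_le
        by (intro diff_le_integral_of_deriv_le[where d = "\<lambda>r. (H0 r + K r) * f r - f r ^ 5 / r ^ 4"] sub cSf)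
          (auto intro!: DERIV_subset[OF g'])
      then show ?thesis by simp
    qed
    have \<Phi>_mono: "?\<Phi> t \<le> ?\<Phi> s" if "0 < s" "s \<le> t" "t \<le> b" for s t
      using that rb
      by (intro integral_subset_le integrable_continuous_interval sub cSf) (auto simp: S_def intro!: mult_nonneg_nonneg less_imp_le[OF f_pos])
    have \<Phi>0: "0 \<le> ?\<Phi> s" if "0 < s" "s \<le> b" for s
      using \<Phi>_mono[of s b] that by simp
    have f_le: "f s \<le> A b + ?\<Phi> s" if "0 < s" "s \<le> b" for s
    proof -
      have "- f b - (- f s) \<le> integral {s..b} (\<lambda>_. \<bar>g b\<bar> + ?\<Phi> s)"
      proof (rule diff_le_integral_of_deriv_le[where d = "\<lambda>r. - g r"])
        fix t assume t: "t \<in> {s..b}"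
        show "((\<lambda>r. - f r) has_real_derivative - g t) (at t within {s..b})"
          using t that rb by (intro DERIV_minus DERIV_subset[OF f']) auto
        show "- g t \<le> \<bar>g b\<bar> + ?\<Phi> s"
          using g_ge[of t] \<Phi>_mono[of s t] t that by auto
      qed (use that in auto)
      also have "\<dots> = (b - s) * (\<bar>g b\<bar> + ?\<Phi> s)"
        using that by simp
      also have "\<dots> \<le> 1 * (\<bar>g b\<bar> + ?\<Phi> s)"
        using that rb \<Phi>0[OF that] by (intro mult_right_mono) auto
      finally show ?thesis by (simp add: A_def)
    qed
    have "A b + ?\<Phi> r \<le> A b * exp (integral {r..b} S)"
      using rb f_le by (intro backward_gronwall sub cS cf) (auto simp: S_def)
    also have "\<dots> \<le> A b * exp M"
      using S_le[OF rb] A0 by (intro mult_left_mono) auto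
    finally have main: "A b + ?\<Phi> r \<le> A b * exp M" .
    show "f r \<le> A b * exp M" using f_le[of r] rb main by simp
    show "?\<Phi> r \<le> A b * exp M" using A0 main by simp
    have "\<bar>g b\<bar> \<le> A b" using f_pos[of b] rb by (simp add: A_def)
    then show "- (A b * exp M) \<le> g r"
      using g_ge[of r] rb main by linarith
  qed
  have lim_id: "((\<lambda>r. r) \<longlongrightarrow> 0) (at_right (0::real))" by (rule tendsto_ident_at)
  have f_0: "(f \<longlongrightarrow> 0) (at_right 0)"
  proof (rule Lim_transform_eventually)
    show "((\<lambda>r. r * (f r / r)) \<longlongrightarrow> 0) (at_right 0)"
      using tendsto_mult[OF lim_id f0] by simp
    show "\<forall>\<^sub>F r in at_right 0. r * (f r / r) = f r"
      by (simp add: eventually_at_right_less eventually_at_filter)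
  qed
  have P_0: "(P \<longlongrightarrow> 0) (at_right 0)"
    using tendsto_diff[OF tendsto_mult[OF lim_id g0] f_0] by (simp add: P_def[abs_def])
  \<comment> \<open>Here P' is at most \<open>S r * f r\<close>, and its integral is already
    bounded. The lower end \<open>a\<close> tends to 0 because the equation is only available on the
    open interval.\<close>
  have P_le: "P r \<le> A b * exp M" if rb: "0 < r" "r \<le> b" "b < 1" for r b
  proof (rule tendsto_upperbound)
    show "((\<lambda>a. P r - P a) \<longlongrightarrow> P r) (at_right 0)"
      using tendsto_diff[OF tendsto_const P_0] by simp
    have "P r - P a \<le> A b * exp M" if a: "0 < a" "a < r" for a
    proof -
      have "P r - P a \<le> integral {a..r} (\<lambda>s. S s * f s)"
      proof (rule diff_le_integral_of_deriv_le)
        fix t assume t: "t \<in> {a..r}"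
        then have t01: "0 < t" "t < 1" using a rb by auto
        show "(P has_real_derivative t * ((H0 t + K t) * f t - f t ^ 5 / t ^ 4)) (at t within {a..r})"
          unfolding P_def
          by (rule DERIV_subset[where s = UNIV])
             (auto intro!: derivative_eq_intros f' g' t01)
        have "t * ((H0 t + K t) * f t - f t ^ 5 / t ^ 4) \<le> t * (S t * f t)"
          using t01 g'_le by (intro mult_left_mono) auto
        also have "\<dots> \<le> 1 * (S t * f t)"
          using t01 f_pos[OF t01] by (intro mult_right_mono) (auto simp: S_def)
        finally show "t * ((H0 t + K t) * f t - f t ^ 5 / t ^ 4) \<le> S t * f t" by simp
      qed (use a rb in \<open>auto intro!: sub cSf\<close>)
      also have "\<dots> \<le> integral {a..b} (\<lambda>s. S s * f s)"
        using a rb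
        by (intro integral_subset_le integrable_continuous_interval sub cSf)
          (auto simp: S_def intro!: mult_nonneg_nonneg less_imp_le[OF f_pos])
      also have "\<dots> \<le> A b * exp M" using bnd(3)[of a b] a rb by simp
      finally show ?thesis .
    qed
    then show "\<forall>\<^sub>F a in at_right 0. P r - P a \<le> A b * exp M"
      using rb by (auto simp: eventually_at_right_field)
  qed simp
  \<comment> \<open>This is the multiplier of \<open>K r\<close> in the derivative of
    \<open>Q\<close>. Since r g = P + f, both bounds together give |r g| \<le> 2 E with E =
    \<open>A b * exp M\<close>; the 5 is 4 from the mixed term plus 1 from f^2.\<close>
  have w'_le: "\<bar>2 * r * f r * g r - (f r)\<^sup>2\<bar> \<le> 5 * (A b * exp M)\<^sup>2" if rb: "0 < r" "r \<le> b" "b < 1" for r b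
  proof -
    let ?E = "A b * exp M"
    have E0: "0 \<le> ?E" using f_pos[of b] rb by (simp add: A_def)
    have fr: "0 \<le> f r" "f r \<le> ?E" using bnd(1)[OF rb] f_pos[of r] rb by auto
    have "- (1 * ?E) \<le> - (r * ?E)" using rb E0 by (intro le_imp_neg_le mult_right_mono) auto
    also have "\<dots> \<le> r * g r" using mult_left_mono[OF bnd(2)[OF rb], of r] rb by simp
    finally have "\<bar>r * g r\<bar> \<le> 2 * ?E"
      using P_le[OF rb] fr E0 by (auto simp: P_def)
    then have "f r * \<bar>r * g r\<bar> \<le> ?E * (2 * ?E)"
      using fr by (intro mult_mono) auto
    then have 1: "\<bar>2 * r * f r * g r\<bar> \<le> 4 * ?E\<^sup>2"
      using fr by (simp add: abs_mult power2_eq_square mult_ac)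
    have "(f r)\<^sup>2 \<le> ?E\<^sup>2" using fr by (intro power_mono) auto
    then show ?thesis
      using 1 by (smt (verit) zero_le_power2)
  qed
  \<comment> \<open>Writing f^6 / r^3 as f^3 (f / r)^3 shows that the singular term vanishes at 0.
    Of \<open>H0\<close> only boundedness is known there, hence the sandwich.\<close>
  have Q_0: "(Q \<longlongrightarrow> 0) (at_right 0)"
  proof (rule Lim_transform_eventually)
    have "((\<lambda>r. H0 r * (r * (f r)\<^sup>2)) \<longlongrightarrow> 0) (at_right 0)"
    proof (rule tendsto_rabs_zero_cancel, rule tendsto_sandwich[OF _ _ tendsto_const])
      show "((\<lambda>r. m * \<bar>r * (f r)\<^sup>2\<bar>) \<longlongrightarrow> 0) (at_right 0)"
        using tendsto_mult[OF tendsto_const[of m] tendsto_rabs[OF tendsto_mult[OF lim_id tendsto_power[OF f_0, of 2]]]]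
        by simp
      show "\<forall>\<^sub>F r in at_right 0. \<bar>H0 r * (r * (f r)\<^sup>2)\<bar> \<le> m * \<bar>r * (f r)\<^sup>2\<bar>"
        using H0_le by (auto simp: eventually_at_right_field abs_mult intro!: exI[of _ 1] mult_right_mono)
    qed auto
    moreover have "((\<lambda>r. r * (g r)\<^sup>2 + f r ^ 3 * (f r / r) ^ 3 / 3 - f r * g r) \<longlongrightarrow> 0) (at_right 0)"
      by (rule tendsto_eq_intros lim_id g0 f_0 f0 | simp)+
    ultimately show "((\<lambda>r. r * (g r)\<^sup>2 + f r ^ 3 * (f r / r) ^ 3 / 3 - f r * g r - H0 r * (r * (f r)\<^sup>2)) \<longlongrightarrow> 0) (at_right 0)"
      by (rule tendsto_diff[where a = 0 and b = 0, simplified, rotated])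
    show "\<forall>\<^sub>F r in at_right 0. r * (g r)\<^sup>2 + f r ^ 3 * (f r / r) ^ 3 / 3 - f r * g r - H0 r * (r * (f r)\<^sup>2) = Q r"
      by (auto simp: eventually_at_right_field Q_def power_divide mult_ac simp flip: power_add intro!: exI[of _ 1])
  qed
  \<comment> \<open>All terms with f^5 g and f^6 cancel, which is where the critical exponent 5 in
    dimension 3 enters; so do the g^2 terms and those with H0 f g.\<close>
  have Q': "(Q has_real_derivative - (2 * (H0 r + 1 / 2 * (r * D r)) * (f r)\<^sup>2) + K r * (2 * r * f r * g r - (f r)\<^sup>2)) (at r)"
    if r: "0 < r" "r < 1" for r
  proof -
    have r0: "r \<noteq> 0" and r3: "3 * r ^ 3 \<noteq> 0" using r by auto
    have "(Q has_real_derivative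
        ((g r)\<^sup>2 + r * (2 * g r * ((H0 r + K r) * f r - f r ^ 5 / r ^ 4)))
        + (6 * f r ^ 5 * g r * (3 * r ^ 3) - f r ^ 6 * (9 * r\<^sup>2)) / (3 * r ^ 3)\<^sup>2
        - (g r * g r + f r * ((H0 r + K r) * f r - f r ^ 5 / r ^ 4))
        - ((D r * r + H0 r) * (f r)\<^sup>2 + H0 r * r * (2 * f r * g r))) (at r)"
      unfolding Q_def
      by (rule derivative_eq_intros f'[OF r] g'[OF r] H0'[OF r] refl r3 | simp add: algebra_simps power2_eq_square)+
    also have "((g r)\<^sup>2 + r * (2 * g r * ((H0 r + K r) * f r - f r ^ 5 / r ^ 4)))
        + (6 * f r ^ 5 * g r * (3 * r ^ 3) - f r ^ 6 * (9 * r\<^sup>2)) / (3 * r ^ 3)\<^sup>2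
        - (g r * g r + f r * ((H0 r + K r) * f r - f r ^ 5 / r ^ 4))
        - ((D r * r + H0 r) * (f r)\<^sup>2 + H0 r * r * (2 * f r * g r))
      = - (2 * (H0 r + 1 / 2 * (r * D r)) * (f r)\<^sup>2) + K r * (2 * r * f r * g r - (f r)\<^sup>2)"
      using r0 by (simp add: divide_simps) algebra
    finally show ?thesis .
  qed
  \<comment> \<open>The \<open>H0\<close> part of the derivative is nonpositive by
    \<open>mono\<close> and is dropped, so only the perturbation \<open>K\<close> contributes to
    \<open>Q b\<close>.\<close>
  have Q_le: "Q b \<le> 5 * (A b * exp M)\<^sup>2 * \<kappa>" if b: "0 < b" "b < 1" for b
  proof (rule tendsto_upperbound)
    let ?C = "5 * (A b * exp M)\<^sup>2"
    show "((\<lambda>a. Q b - Q a) \<longlongrightarrow> Q b) (at_right 0)"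
      using tendsto_diff[OF tendsto_const Q_0] by simp
    have "Q b - Q a \<le> ?C * \<kappa>" if a: "0 < a" "a < b" for a
    proof -
      have "Q b - Q a \<le> integral {a..b} (\<lambda>r. ?C * \<bar>K r\<bar>)"
      proof (rule diff_le_integral_of_deriv_le)
        fix r assume "r \<in> {a..b}"
        then have r: "0 < r" "r \<le> b" "r < 1" using a b by auto
        show "(Q has_real_derivative - (2 * (H0 r + 1 / 2 * (r * D r)) * (f r)\<^sup>2) + K r * (2 * r * f r * g r - (f r)\<^sup>2)) (at r within {a..b})"
          using Q' r by (blast intro: DERIV_subset)
        have "K r * (2 * r * f r * g r - (f r)\<^sup>2) \<le> \<bar>K r\<bar> * \<bar>2 * r * f r * g r - (f r)\<^sup>2\<bar>"
          by (metis abs_ge_self abs_mult)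
        also have "\<dots> \<le> \<bar>K r\<bar> * ?C"
          using w'_le[OF r(1,2) b(2)] by (intro mult_left_mono) auto
        finally show "- (2 * (H0 r + 1 / 2 * (r * D r)) * (f r)\<^sup>2) + K r * (2 * r * f r * g r - (f r)\<^sup>2) \<le> ?C * \<bar>K r\<bar>"
          using mono[OF r(1,3)] by (smt (verit) mult.commute mult_nonneg_nonneg zero_le_power2)
      qed (use a b K in \<open>auto intro!: continuous_intros sub\<close>)
      also have "\<dots> = ?C * integral {a..b} (\<lambda>r. \<bar>K r\<bar>)" by simp
      also have "\<dots> \<le> ?C * \<kappa>" using a b small[of a b] by (intro mult_left_mono) auto
      finally show ?thesis .
    qed
    then show "\<forall>\<^sub>F a in at_right 0. Q b - Q a \<le> ?C * \<kappa>"
      using b by (auto simp: eventually_at_right_field)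
  qed simp
  \<comment> \<open>From x^2 / 4 \<le> e^2 / 4 + e x + m e^2 and e x \<le> 2 e^2 + x^2 / 8, with e =
    f(b) and x = |g(b)|, one gets x^2 \<le> (18 + 8 m) e^2.\<close>
  define L where "L = 18 + 8 * m"
  have A_le: "A b \<le> (1 + L) * f b" if b: "1 / 2 \<le> b" "b < 1" for b
  proof -
    define e x where "e = f b" and "x = \<bar>g b\<bar>"
    have e0: "0 < e" and x0: "0 \<le> x" using f_pos[of b] b by (auto simp: e_def x_def)
    \<comment> \<open>The 40 in the hypothesis on \<kappa> is 5 * 8: it leaves (e + x)^2 / 8 \<le>
      (e^2 + x^2) / 4, and the x^2 part is absorbed by b x^2 \<ge> x^2 / 2 in
      \<open>Q b\<close>.\<close>
    have "5 * (A b * exp M)\<^sup>2 * \<kappa> = (40 * exp (2 * (m + 1)) * \<kappa>) * ((e + x)\<^sup>2 / 8)"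
      by (simp add: A_def e_def x_def M_def power_mult_distrib flip: exp_double)
    also have "\<dots> \<le> 1 * ((e + x)\<^sup>2 / 8)"
      using \<kappa> by (intro mult_right_mono) auto
    also have "\<dots> \<le> (e\<^sup>2 + x\<^sup>2) / 4"
      using sum_squares_bound[of e x] by (simp add: power2_sum)
    finally have Qb: "Q b \<le> (e\<^sup>2 + x\<^sup>2) / 4" using Q_le[of b] b by simp
    have "1 / 2 * x\<^sup>2 \<le> b * x\<^sup>2" using b by (intro mult_right_mono) auto
    then have "1 / 2 * x\<^sup>2 \<le> b * (g b)\<^sup>2" by (simp add: x_def)
    moreover have "0 \<le> f b ^ 6 / (3 * b ^ 3)" using e0 b by (simp add: e_def)
    moreover have "f b * g b \<le> e * x" using e0 by (auto simp: e_def x_def intro!: mult_left_mono)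
    moreover have "H0 b * b * (f b)\<^sup>2 \<le> m * 1 * e\<^sup>2"
      using H0_le[of b] b m0 unfolding e_def by (intro mult_right_mono mult_mono) auto
    ultimately have "x\<^sup>2 / 4 \<le> e\<^sup>2 / 4 + e * x + m * e\<^sup>2"
      using Qb by (simp add: Q_def)
    moreover have "e * x \<le> 2 * e\<^sup>2 + x\<^sup>2 / 8"
      using zero_le_power2[of "4 * e - x"] by (simp add: power2_eq_square algebra_simps)
    ultimately have "x\<^sup>2 \<le> L * e\<^sup>2" by (simp add: L_def algebra_simps)
    \<comment> \<open>Since \<open>L\<close> is at least 1, it can replace its square root.\<close>
    also have "\<dots> \<le> (L * e)\<^sup>2"
      using m0 mult_right_mono[of 1 L "L * e\<^sup>2"] by (simp add: L_def power_mult_distrib power2_eq_square[of "18 + 8 * m"] mult.assoc)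
    finally have "x \<le> L * e"
      using e0 m0 by (auto simp: L_def intro: power2_le_imp_le)
    then show ?thesis by (simp add: A_def e_def x_def algebra_simps)
  qed
  \<comment> \<open>At a fixed interior point f is bounded by a constant times f(b), which tends to
    0 as b tends to 1.\<close>
  have "f (1 / 2) \<le> 0"
  proof (rule tendsto_lowerbound)
    show "((\<lambda>b. (1 + L) * f b * exp M) \<longlongrightarrow> 0) (at_left 1)"
      using f1 by (auto intro!: tendsto_eq_intros)
    have "f (1 / 2) \<le> (1 + L) * f b * exp M" if "1 / 2 < b" "b < 1" for b
      using bnd(1)[of "1 / 2" b] A_le[of b] that by (auto intro: order_trans mult_right_mono)
    then show "\<forall>\<^sub>F b in at_left 1. f (1 / 2) \<le> (1 + L) * f b * exp M"
      by (auto simp: eventually_at_left_field intro!: exI[of _ "1 / 2"])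
  qed simp
  then show False using f_pos[of "1 / 2"] by simp
qed

section \<open>Radial functions and polar coordinates\<close>

lemma DERIV_partial_line:
  fixes f :: "'a::euclidean_space \<Rightarrow> real"
  assumes "f differentiable (at (t *\<^sub>R e))"
  shows "((\<lambda>s. f (s *\<^sub>R e)) has_real_derivative partial_deriv e f (t *\<^sub>R e)) (at t)"
proof -
  define F where "F = frechet_derivative f (at (t *\<^sub>R e))"
  have F: "(f has_derivative F) (at (t *\<^sub>R e))"
    unfolding F_def using assms by (simp add: frechet_derivative_works)
  have "((\<lambda>s. f (s *\<^sub>R e)) has_derivative (\<lambda>x. F (x *\<^sub>R e))) (at t)"
    by (rule has_derivative_compose[of "\<lambda>s. s *\<^sub>R e" "\<lambda>s. s *\<^sub>R e" t UNIV f F])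
      (auto intro!: derivative_eq_intros F)
  moreover have "F (x *\<^sub>R e) = F e * x" for x
    using linear_scale[OF has_derivative_linear[OF F]] by simp
  ultimately show ?thesis
    by (simp add: has_field_derivative_def F_def partial_deriv_def)
qed

lemma has_derivative_comp_norm:
  fixes x b :: "'a::euclidean_space"
  assumes "x \<noteq> 0" and "(\<phi> has_real_derivative d) (at (norm x))"
  shows "((\<lambda>y. \<phi> (norm y)) has_derivative (\<lambda>v. d * (sgn x \<bullet> v))) (at x)"
proof -
  have "(norm has_derivative (\<lambda>v. sgn x \<bullet> v)) (at x)"
    using GDERIV_norm[OF assms(1)] by (simp add: gderiv_def inner_commute)
  from has_derivative_compose[OF this, of \<phi> "(*) d"] assms(2)
  show ?thesis by (simp add: has_field_derivative_def)
qed

lemma partial_deriv_cong_open: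
  assumes "open S" "x \<in> S" "\<And>y. y \<in> S \<Longrightarrow> f y = g y" "(g has_derivative g') (at x)"
  shows "partial_deriv b f x = g' b"
  using assms by (intro partial_deriv_eq has_derivative_transform_within_open[of g g' x UNIV S f]) auto

text \<open>The first partials are (\<phi>'(r) / r) x_b; differentiating once more and summing uses
  that the squares of the coordinates add up to r^2.\<close>

lemma laplacian_radial:
  fixes u :: "'a::euclidean_space \<Rightarrow> real"
  assumes u: "\<And>y. y \<in> ball 0 R \<Longrightarrow> u y = \<phi> (norm y)"
    and 1: "\<And>t. 0 < t \<Longrightarrow> t < R \<Longrightarrow> (\<phi> has_real_derivative \<phi>' t) (at t)"
    and 2: "\<And>t. 0 < t \<Longrightarrow> t < R \<Longrightarrow> (\<phi>' has_real_derivative \<phi>'' t) (at t)"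
    and x: "x \<in> ball 0 R" "x \<noteq> 0"
  shows "laplacian u x = - (\<phi>'' (norm x) + (DIM('a) - 1) / norm x * \<phi>' (norm x))"
proof -
  \<comment> \<open>The norm is not differentiable at 0. Openness of \<open>S\<close> allows the
    formula for the first partials to be differentiated again.\<close>
  define S where "S = ball (0::'a) R - {0}"
  have S: "open S" "x \<in> S" unfolding S_def using x by (auto intro: open_delete)
  have S_iff: "y \<in> S \<longleftrightarrow> 0 < norm y \<and> norm y < R" for y by (auto simp: S_def)
  have pd: "partial_deriv b u y = \<phi>' (norm y) / norm y * (y \<bullet> b)" if "y \<in> S" for y b
  proof -
    have "partial_deriv b u y = \<phi>' (norm y) * (sgn y \<bullet> b)"
      using that by (intro partial_deriv_cong_open[OF S(1) that u] has_derivative_comp_norm 1) (auto simp: S_def)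
    then show ?thesis by (simp add: sgn_div_norm divide_simps)
  qed
  let ?r = "norm x"
  have r: "0 < ?r" "?r < R" using x by auto
  \<comment> \<open>The derivative of \<phi>'(t) / t at t = |x|.\<close>
  define q where "q = (\<phi>'' ?r * ?r - \<phi>' ?r) / ?r\<^sup>2"
  have pd2: "partial_deriv b (partial_deriv b u) x = q / ?r * (x \<bullet> b)\<^sup>2 + \<phi>' ?r / ?r" if b: "b \<in> Basis" for b
  proof -
    have "((\<lambda>t. \<phi>' t / t) has_real_derivative q) (at ?r)"
      unfolding q_def using r by (auto intro!: derivative_eq_intros 2 simp: power2_eq_square)
    then have "((\<lambda>y. \<phi>' (norm y) / norm y) has_derivative (\<lambda>v. q * (sgn x \<bullet> v))) (at x)"
      using x by (intro has_derivative_comp_norm) auto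
    from has_derivative_mult[OF this bounded_linear_imp_has_derivative[OF bounded_linear_inner_left[of b]]]
    have "((\<lambda>y. \<phi>' (norm y) / norm y * (y \<bullet> b)) has_derivative
        (\<lambda>v. \<phi>' ?r / ?r * (v \<bullet> b) + q * (sgn x \<bullet> v) * (x \<bullet> b))) (at x)"
      .
    from partial_deriv_cong_open[OF S pd this]
    have "partial_deriv b (partial_deriv b u) x = \<phi>' ?r / ?r * (b \<bullet> b) + q * (sgn x \<bullet> b) * (x \<bullet> b)" .
    then show ?thesis
      using b by (simp add: sgn_div_norm inner_Basis divide_simps power2_eq_square)
  qed
  have "(\<Sum>b\<in>Basis. partial_deriv b (partial_deriv b u) x)
      = q / ?r * (\<Sum>b\<in>Basis. (x \<bullet> b)\<^sup>2) + DIM('a) * (\<phi>' ?r / ?r)"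
    by (simp add: pd2 sum.distrib sum_distrib_left sum_divide_distrib)
  also have "(\<Sum>b\<in>Basis. (x \<bullet> b)\<^sup>2) = ?r\<^sup>2"
    unfolding power2_norm_eq_inner by (subst euclidean_inner) (simp add: power2_eq_square)
  also have "q / ?r * ?r\<^sup>2 + DIM('a) * (\<phi>' ?r / ?r) = \<phi>'' ?r + (DIM('a) - 1) / ?r * \<phi>' ?r"
    using r by (simp add: q_def field_simps power2_eq_square of_nat_diff Suc_leI[OF DIM_positive])
  finally show ?thesis by (simp add: laplacian_def)
qed

text \<open>Polar coordinates for radial integrands, stated as an image measure. Two such measures
  agree once they agree on all half-lines \<open>{t<..}\<close>, and there both sides are the volume
  of a spherical shell.\<close>

lemma distr_norm_lborel_ball:
  assumes "0 \<le> R"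
  shows "distr (restrict_space lborel (ball (0::'a::euclidean_space) R)) borel norm =
    density lborel (\<lambda>r. ennreal (unit_ball_vol DIM('a) * DIM('a) * r ^ (DIM('a) - 1)) * indicator {0..R} r)"
    (is "?M = ?N")
proof (rule measure_eqI_lessThan)
  let ?c = "unit_ball_vol (real DIM('a))" and ?n = "DIM('a)"
  have c: "0 \<le> ?c" by simp
  have meas: "norm \<in> restrict_space lborel (ball (0::'a) R) \<rightarrow>\<^sub>M borel"
    by (intro measurable_restrict_space1) simp
  have M: "emeasure ?M {t<..} = emeasure lborel (ball (0::'a) R - cball 0 t)" for t
  proof -
    have "norm -` {t<..} \<inter> ball (0::'a) R = ball 0 R - cball 0 t" by auto
    then show ?thesis
      by (subst emeasure_distr[OF meas])
        (auto simp: space_restrict_space emeasure_restrict_space)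
  qed
  \<comment> \<open>The density vanishes for negative radii, so \<open>t\<close> is replaced by
    \<open>max 0 t\<close>; the endpoint \<open>t\<close> itself is a null set.\<close>
  have N: "emeasure ?N {t<..} = ennreal (?c * R ^ ?n - ?c * s ^ ?n)" if "s = max 0 t" "s \<le> R" for t s
  proof -
    have "emeasure ?N {t<..} =
        (\<integral>\<^sup>+r. ennreal (?c * ?n * r ^ (?n - 1)) * indicator {s..R} r \<partial>lborel)"
      by (subst emeasure_density, simp, simp, rule nn_integral_cong_AE)
        (use AE_lborel_singleton[of t] that in \<open>auto elim!: eventually_mono simp: indicator_def\<close>)
    also have "\<dots> = ennreal (?c * R ^ ?n - ?c * s ^ ?n)"
      using that c by (intro nn_integral_FTC_Icc) (auto intro!: derivative_eq_intros mult_nonneg_nonneg)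
    finally show ?thesis .
  qed
  show "emeasure ?M {t<..} < \<infinity>" for t
    unfolding M by (rule le_less_trans[OF emeasure_mono[of _ "ball 0 R"]])
      (use assms in \<open>auto simp: emeasure_ball\<close>)
  show "emeasure ?M {t<..} = emeasure ?N {t<..}" for t
  proof (cases "t < R")
    case True
    have 0: "emeasure lborel (cball (0::'a) t) = ennreal (?c * max 0 t ^ ?n)"
      by (cases "0 \<le> t") (auto simp: emeasure_cball max_def)
    have "emeasure lborel (ball (0::'a) R - cball 0 t) = emeasure lborel (ball (0::'a) R) - emeasure lborel (cball (0::'a) t)"
      using True by (intro emeasure_Diff) (auto simp: 0)
    also have "\<dots> = ennreal (?c * R ^ ?n - ?c * max 0 t ^ ?n)"
      unfolding 0 using assms by (simp add: emeasure_ball ennreal_minus)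
    finally show ?thesis using M N[of "max 0 t" t] True assms by simp
  next
    case False
    then have "ball (0::'a) R - cball 0 t = {}" by auto
    then have "emeasure lborel (ball (0::'a) R - cball 0 t) = 0" by (simp only: emeasure_empty)
    moreover have "emeasure ?N {t<..} = 0"
      using False by (subst emeasure_density) (auto simp: nn_integral_0_iff_AE indicator_def)
    ultimately show ?thesis by (simp add: M)
  qed
qed auto

text \<open>Polar coordinates turn the left side into the integral of \<open>k\<close> over the
  shell a \<le> |x| \<le> b, and \<open>k\<close> is nonnegative on the rest of the ball. The radial
  form of \<open>k\<close> is required only on that shell.\<close>

lemma radial_weighted_integral_le:
  fixes k :: "'a::euclidean_space \<Rightarrow> real" and F :: "real \<Rightarrow> real"
  assumes k: "set_integrable lborel (ball 0 R) k" "\<And>x. x \<in> ball 0 R \<Longrightarrow> 0 \<le> k x"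
    and F: "continuous_on {a..b} F" "\<And>r. r \<in> {a..b} \<Longrightarrow> 0 \<le> F r"
    and eq: "\<And>x. norm x \<in> {a..b} \<Longrightarrow> k x = F (norm x)"
    and ab: "0 \<le> a" "b < R" "0 \<le> R"
  shows "unit_ball_vol DIM('a) * DIM('a) * integral {a..b} (\<lambda>r. r ^ (DIM('a) - 1) * F r)
    \<le> (LINT x:ball 0 R|lborel. k x)"
proof -
  let ?n = "DIM('a)"
  define c where "c = unit_ball_vol (real ?n) * ?n"
  have c: "0 \<le> c" by (simp add: c_def)
  \<comment> \<open>Cutting off outside \<open>{a..b}\<close> gives a function measurable on the
    whole line, although \<open>F\<close> is continuous only on the interval.\<close>
  define \<psi> where "\<psi> r = ennreal (indicator {a..b} r *\<^sub>R F r)" for r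
  have [measurable]: "\<psi> \<in> borel_measurable borel"
    unfolding \<psi>_def using F(1) by (intro measurable_compose[OF borel_measurable_continuous_on_indicator]) auto
  have meas: "norm \<in> restrict_space lborel (ball (0::'a) R) \<rightarrow>\<^sub>M borel"
    by (intro measurable_restrict_space1) simp
  have "ennreal (c * integral {a..b} (\<lambda>r. r ^ (?n - 1) * F r))
      = (\<integral>\<^sup>+r. ennreal (c * (r ^ (?n - 1) * F r)) * indicator {a..b} r \<partial>lborel)"
    using ab c F
    by (intro nn_integral_has_integral_lebesgue'[symmetric] has_integral_mult_right integrable_integral
        integrable_continuous_interval continuous_intros) auto
  also have "\<dots> = (\<integral>\<^sup>+r. ennreal (c * r ^ (?n - 1)) * indicator {0..R} r * \<psi> r \<partial>lborel)"
    using ab c F by (intro nn_integral_cong) (auto simp: \<psi>_def indicator_def ennreal_mult[symmetric] mult_ac)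
  also have "\<dots> = (\<integral>\<^sup>+r. \<psi> r \<partial>distr (restrict_space lborel (ball (0::'a) R)) borel norm)"
    unfolding distr_norm_lborel_ball[OF ab(3)] c_def by (subst nn_integral_density) auto
  also have "\<dots> = (\<integral>\<^sup>+x. \<psi> (norm x) * indicator (ball (0::'a) R) x \<partial>lborel)"
    by (subst nn_integral_distr[OF meas]) (auto simp: nn_integral_restrict_space)
  also have "\<dots> \<le> (\<integral>\<^sup>+x. ennreal (indicator (ball 0 R) x *\<^sub>R k x) \<partial>lborel)"
    using k(2) eq by (intro nn_integral_mono) (auto simp: \<psi>_def indicator_def)
  also have "\<dots> = ennreal (LINT x:ball 0 R|lborel. k x)"
    unfolding set_lebesgue_integral_def using k
    by (intro nn_integral_eq_integral) (auto simp: set_integrable_def indicator_def)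
  finally show ?thesis
    using k(2) unfolding c_def
    by (subst (asm) ennreal_le_iff) (auto simp: set_lebesgue_integral_def indicator_def intro!: integral_nonneg_AE)
qed

section \<open>From the L^p norm with weight r^2 to the L^1 norm on a ray\<close>

text \<open>
  Either y is at most \<epsilon> r powr (-2 / (p - 1)), whose integral over (0,1) is finite exactly
  because p > 3, or y is controlled by the weighted power.
\<close>
lemma le_powr_add_weighted_powr:
  fixes y r p \<epsilon> :: real
  assumes "1 < p" "0 < \<epsilon>" "0 < r" "0 \<le> y"
  shows "y \<le> \<epsilon> * r powr (- (2 / (p - 1))) + \<epsilon> powr (1 - p) * (r\<^sup>2 * y powr p)"
proof (cases "y \<le> \<epsilon> * r powr (- (2 / (p - 1)))")
  case True
  then show ?thesis by (smt (verit) mult_nonneg_nonneg powr_ge_zero zero_le_power2)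
next
  case False
  define z where "z = \<epsilon> * r powr (- (2 / (p - 1)))"
  have z: "0 < z" "z < y" using False assms by (auto simp: z_def)
  \<comment> \<open>The exponent 1 - p is negative, so replacing y by the smaller z increases the
    second factor.\<close>
  have "y = y powr p * y powr (1 - p)" using z by (simp flip: powr_add)
  also have "\<dots> \<le> y powr p * z powr (1 - p)"
    using z assms by (intro mult_left_mono powr_mono2') auto
  also have "z powr (1 - p) = \<epsilon> powr (1 - p) * r powr (- (2 / (p - 1)) * (1 - p))"
    using assms by (simp add: z_def powr_mult powr_powr)
  \<comment> \<open>The exponent in the threshold is chosen to produce exactly the weight
    r^2.\<close>
  also have "- (2 / (p - 1)) * (1 - p) = 2" using assms by (simp add: field_simps)
  also have "r powr 2 = r\<^sup>2" using assms by simp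
  finally have "y \<le> \<epsilon> powr (1 - p) * (r\<^sup>2 * y powr p)" by (simp add: mult_ac)
  moreover have "0 < \<epsilon> * r powr (- (2 / (p - 1)))" using z by (simp add: z_def)
  ultimately show ?thesis by linarith
qed

text \<open>The pointwise splitting is integrated; \<alpha> = 2 / (p - 1) is below 1, so the first
  term contributes at most \<epsilon> / (1 - \<alpha>). The free \<epsilon> lets both terms be made
  small, independently of \<open>a\<close> and \<open>b\<close>.\<close>

lemma integral_abs_le_weighted_powr:
  fixes K :: "real \<Rightarrow> real"
  assumes K: "continuous_on {a..b} K" and ab: "0 < a" "a \<le> b" "b \<le> 1" and p: "3 < p" and \<epsilon>: "0 < \<epsilon>"
  shows "integral {a..b} (\<lambda>r. \<bar>K r\<bar>)
    \<le> \<epsilon> * ((p - 1) / (p - 3)) + \<epsilon> powr (1 - p) * integral {a..b} (\<lambda>r. r\<^sup>2 * \<bar>K r\<bar> powr p)"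
proof -
  define \<alpha> where "\<alpha> = 2 / (p - 1)"
  have \<alpha>: "\<alpha> < 1" "1 / (1 - \<alpha>) = (p - 1) / (p - 3)"
    using p by (auto simp: \<alpha>_def field_simps)
  have c1: "continuous_on {a..b} (\<lambda>r. r powr - \<alpha>)"
    using ab by (intro continuous_intros) auto
  have c2: "continuous_on {a..b} (\<lambda>r. r\<^sup>2 * \<bar>K r\<bar> powr p)"
    using p by (intro continuous_intros continuous_on_powr' K) auto
  have "((\<lambda>r. r powr - \<alpha>) has_integral b powr (1 - \<alpha>) / (1 - \<alpha>) - a powr (1 - \<alpha>) / (1 - \<alpha>)) {a..b}"
    using ab \<alpha>
    by (intro fundamental_theorem_of_calculus)
      (auto intro!: derivative_eq_intros simp flip: has_real_derivative_iff_has_vector_derivative)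
  then have "integral {a..b} (\<lambda>r. r powr - \<alpha>) = b powr (1 - \<alpha>) / (1 - \<alpha>) - a powr (1 - \<alpha>) / (1 - \<alpha>)"
    by (rule integral_unique)
  also have "\<dots> \<le> 1 / (1 - \<alpha>)"
    unfolding diff_divide_distrib[symmetric]
  proof (intro divide_right_mono)
    have "b powr (1 - \<alpha>) \<le> 1"
      using ab \<alpha>(1) powr_mono2[of "1 - \<alpha>" b 1] by simp
    then show "b powr (1 - \<alpha>) - a powr (1 - \<alpha>) \<le> 1"
      using powr_ge_zero[of a "1 - \<alpha>"] by linarith
  qed (use \<alpha>(1) in simp)
  finally have i1: "integral {a..b} (\<lambda>r. r powr - \<alpha>) \<le> (p - 1) / (p - 3)" by (simp add: \<alpha>)
  have "integral {a..b} (\<lambda>r. \<bar>K r\<bar>)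
      \<le> integral {a..b} (\<lambda>r. \<epsilon> * r powr - \<alpha> + \<epsilon> powr (1 - p) * (r\<^sup>2 * \<bar>K r\<bar> powr p))"
    using ab p \<epsilon> unfolding \<alpha>_def
    by (intro integral_le integrable_continuous_interval continuous_on_add continuous_on_mult_left
        c1[unfolded \<alpha>_def] c2 continuous_on_rabs K le_powr_add_weighted_powr) auto
  also have "\<dots> = \<epsilon> * integral {a..b} (\<lambda>r. r powr - \<alpha>)
      + \<epsilon> powr (1 - p) * integral {a..b} (\<lambda>r. r\<^sup>2 * \<bar>K r\<bar> powr p)"
    by (subst Henstock_Kurzweil_Integration.integral_add)
      (auto intro!: integrable_continuous_interval continuous_on_mult_left c1 c2)
  also have "\<epsilon> * integral {a..b} (\<lambda>r. r powr - \<alpha>) \<le> \<epsilon> * ((p - 1) / (p - 3))"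
    using i1 \<epsilon> by (intro mult_left_mono) auto
  finally show ?thesis by simp
qed

section \<open>Integrability and continuity of the potentials\<close>

lemma set_integrable_bounded_continuous:
  fixes k :: "'a::euclidean_space \<Rightarrow> real"
  assumes "continuous_on S k" "S \<in> sets borel" "bounded S" "\<And>x. x \<in> S \<Longrightarrow> \<bar>k x\<bar> \<le> C"
  shows "set_integrable lborel S k"
  unfolding set_integrable_def
proof (rule integrableI_bounded_set[where A = S and B = C])
  show "emeasure lborel S < \<infinity>" using assms(3) by (rule emeasure_bounded_finite)
  show "(\<lambda>x. indicator S x *\<^sub>R k x) \<in> borel_measurable lborel"
    using borel_measurable_continuous_on_indicator[OF assms(2,1)] by simp
qed (use assms in auto)

lemma holder_on_imp_continuous_on:
  assumes "holder_on \<eta> S f" "0 < \<eta>"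
  shows "continuous_on S f"
  unfolding continuous_on_def
proof
  fix x assume x: "x \<in> S"
  obtain C where C: "\<And>x y. x \<in> S \<Longrightarrow> y \<in> S \<Longrightarrow> \<bar>f x - f y\<bar> \<le> C * dist x y powr \<eta>"
    using assms(1) by (auto simp: holder_on_def)
  have "((\<lambda>y. C * dist y x powr \<eta>) \<longlongrightarrow> C * 0) (at x within S)"
    using assms(2)
    by (intro tendsto_mult tendsto_const tendsto_zero_powrI[of _ _ _ \<eta>])
       (auto intro!: tendsto_eq_intros)
  then have lim: "((\<lambda>y. C * dist y x powr \<eta>) \<longlongrightarrow> 0) (at x within S)" by simp
  have "((\<lambda>y. f y - f x) \<longlongrightarrow> 0) (at x within S)"
    by (rule Lim_null_comparison[OF _ lim]) (auto simp: eventually_at_filter intro!: always_eventually C x)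
  then show "(f \<longlongrightarrow> f x) (at x within S)" by (simp add: LIM_zero_iff)
qed

section \<open>Radial solutions on the ball\<close>

lemma radial_onD:
  assumes "radial_on S f" "x \<in> S" "y \<in> S" "norm x = norm y"
  shows "f x = f y"
  using assms unfolding radial_on_def by blast

text \<open>Restricting to one ray with f = r u reduces the claim to
  \<open>no_positive_profile\<close>. Taking the ray along a coordinate axis makes the radial
  derivative of \<open>h\<^sub>0\<close> a partial derivative.\<close>

lemma no_positive_radial_solution_of_integral_le:
  fixes h h\<^sub>0 :: "real^3 \<Rightarrow> real"
  defines "e \<equiv> axis 1 (1::real) :: real^3"
  assumes h0: "C1_on B h\<^sub>0" "\<forall>x\<in>B. h\<^sub>0 x + 1 / 2 * (x \<bullet> gradient h\<^sub>0 x) \<ge> 0" "\<And>x. x \<in> B \<Longrightarrow> \<bar>h\<^sub>0 x\<bar> \<le> m"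
    and h: "continuous_on B h"
    and small: "\<And>a b. 0 < a \<Longrightarrow> a \<le> b \<Longrightarrow> b < 1 \<Longrightarrow>
      integral {a..b} (\<lambda>r. \<bar>h (r *\<^sub>R e) - h\<^sub>0 (r *\<^sub>R e)\<bar>) \<le> \<kappa>"
    and \<kappa>: "\<kappa> \<le> 1" "40 * exp (2 * (m + 1)) * \<kappa> \<le> 1"
  shows "\<not> positive_radial_solution h u"
proof
  assume sol: "positive_radial_solution h u"
  have e: "e \<in> Basis" "norm e = 1" by (auto simp: e_def axis_in_Basis_iff)
  have in_B: "t *\<^sub>R e \<in> B" if "-1 < t" "t < 1" for t using e that by auto
  define U where "U t = u (t *\<^sub>R e)" for t
  define U1 where "U1 t = partial_deriv e u (t *\<^sub>R e)" for t
  define U2 where "U2 t = partial_deriv e (partial_deriv e u) (t *\<^sub>R e)" for t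
  \<comment> \<open>The line passes through the centre, so continuity at 0 supplies the one-sided
    limits of \<open>U\<close> and \<open>U1\<close> there.\<close>
  have U: "(U has_real_derivative U1 t) (at t)" and U1: "(U1 has_real_derivative U2 t) (at t)"
    if "-1 < t" "t < 1" for t
    unfolding U_def U1_def U2_def using sol in_B[OF that] e
    by (auto intro!: DERIV_partial_line simp: positive_radial_solution_def C2_on_def C1_on_def)
  have u_eq: "u y = U (norm y)" if "y \<in> B" for y
    unfolding U_def using sol that e
    by (intro radial_onD[of B u]) (auto simp: positive_radial_solution_def)
  have eqn: "U2 r + 2 / r * U1 r = h (r *\<^sub>R e) * U r - U r ^ 5" if r: "0 < r" "r < 1" for r
  proof -
    have "r *\<^sub>R e \<in> B" "r *\<^sub>R e \<noteq> 0" "norm (r *\<^sub>R e) = r" using e r by auto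
    moreover from this have "laplacian u (r *\<^sub>R e) = - (U2 r + 2 / r * U1 r)"
      using laplacian_radial[of 1 u U U1 U2 "r *\<^sub>R e"] u_eq U U1 by auto
    moreover have "laplacian u (r *\<^sub>R e) + h (r *\<^sub>R e) * u (r *\<^sub>R e) = u (r *\<^sub>R e) ^ 5"
      using sol \<open>r *\<^sub>R e \<in> B\<close> unfolding positive_radial_solution_def by blast
    ultimately show ?thesis by (simp add: U_def)
  qed
  have f': "((\<lambda>r. r * U r) has_real_derivative (U r + r * U1 r)) (at r)" if "0 < r" "r < 1" for r
    using that by (auto intro!: derivative_eq_intros U)
  let ?K = "\<lambda>r. h (r *\<^sub>R e) - h\<^sub>0 (r *\<^sub>R e)"
  \<comment> \<open>The factor r removes the first-order term: (r u)'' = r (u'' + 2 u' / r).\<close>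
  have g': "((\<lambda>r. U r + r * U1 r) has_real_derivative
      (h\<^sub>0 (r *\<^sub>R e) + ?K r) * (r * U r) - (r * U r) ^ 5 / r ^ 4) (at r)" if r: "0 < r" "r < 1" for r
  proof -
    have "((\<lambda>r. U r + r * U1 r) has_real_derivative r * (U2 r + 2 / r * U1 r)) (at r)"
      using r by (auto intro!: derivative_eq_intros U U1 simp: field_simps)
    also have "r * (U2 r + 2 / r * U1 r) = (h\<^sub>0 (r *\<^sub>R e) + ?K r) * (r * U r) - (r * U r) ^ 5 / r ^ 4"
      unfolding eqn[OF r] using r by (simp add: field_simps eval_nat_numeral)
    finally show ?thesis .
  qed
  have U0: "(U \<longlongrightarrow> U 0) (at_right 0)" and U10: "(U1 \<longlongrightarrow> U1 0) (at_right 0)"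
    using U[of 0, THEN DERIV_isCont] U1[of 0, THEN DERIV_isCont]
    by (auto simp: isCont_def filterlim_at_split)
  have "continuous_on {0..1} U"
    unfolding U_def
  proof (rule continuous_on_compose2[where g = u and t = "closure B"])
    show "continuous_on (closure B) u" using sol by (simp add: positive_radial_solution_def)
  qed (auto intro!: continuous_intros simp: e(2))
  then have "(U \<longlongrightarrow> U 1) (at_left 1)"
    by (auto simp: continuous_on_def at_within_Icc_at_left dest!: bspec[where x = 1])
  moreover have "U 1 = 0"
    using sol e by (auto simp: positive_radial_solution_def U_def)
  ultimately have U_1: "(U \<longlongrightarrow> 0) (at_left 1)" by simp
  have h0_cont: "continuous_on B h\<^sub>0"
    using h0(1)
    by (auto simp: C1_on_def intro!: continuous_at_imp_continuous_on differentiable_imp_continuous_within)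
  have line: "continuous_on {0<..<1} (\<lambda>r::real. r *\<^sub>R e)" "(\<lambda>r. r *\<^sub>R e) ` {0<..<1} \<subseteq> B"
    using in_B by (force intro!: continuous_intros)+
  have K_cont: "continuous_on {0<..<1} ?K"
    by (rule continuous_on_diff[OF continuous_on_compose2[OF h line] continuous_on_compose2[OF h0_cont line]])
  show False
  proof (rule no_positive_profile[where f = "\<lambda>r. r * U r" and g = "\<lambda>r. U r + r * U1 r" and K = ?K
        and ?H0.0 = "\<lambda>r. h\<^sub>0 (r *\<^sub>R e)" and D = "\<lambda>r. partial_deriv e h\<^sub>0 (r *\<^sub>R e)"
        and m = m and c = "U 0" and \<kappa> = \<kappa>])
    fix r :: real assume r: "0 < r" "r < 1"
    have B: "r *\<^sub>R e \<in> B" using r by (intro in_B) auto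
    show "((\<lambda>r. h\<^sub>0 (r *\<^sub>R e)) has_real_derivative partial_deriv e h\<^sub>0 (r *\<^sub>R e)) (at r)"
      using h0(1) B by (intro DERIV_partial_line) (auto simp: C1_on_def)
    have "e \<bullet> gradient h\<^sub>0 (r *\<^sub>R e) = partial_deriv e h\<^sub>0 (r *\<^sub>R e)"
      using e by (simp add: gradient_def inner_commute[of e])
    then show "0 \<le> h\<^sub>0 (r *\<^sub>R e) + 1 / 2 * (r * partial_deriv e h\<^sub>0 (r *\<^sub>R e))"
      using h0(2) B by fastforce
    show "0 < r * U r" using sol B r by (auto simp: positive_radial_solution_def U_def)
    show "\<bar>h\<^sub>0 (r *\<^sub>R e)\<bar> \<le> m" using h0(3) B by blast
  next
    show "continuous_on {0<..<1} ?K" by (rule K_cont)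
    show "((\<lambda>r. r * U r) \<longlongrightarrow> 0) (at_left 1)"
      using U_1 by (auto intro!: tendsto_eq_intros)
    show "((\<lambda>r. r * U r / r) \<longlongrightarrow> U 0) (at_right 0)"
      by (rule Lim_transform_eventually[OF U0]) (auto simp: eventually_at_filter)
    show "((\<lambda>r. U r + r * U1 r) \<longlongrightarrow> U 0) (at_right 0)"
      by (rule tendsto_eq_intros U0 U10 | simp)+
  qed (use f' g' small \<kappa> in auto)
qed

text \<open>No symmetry of \<open>h\<close> is assumed, but where u > 0 the equation determines
  \<open>h\<close> from u and its Laplacian, and both are radial. This lets the norm over the ball
  control h - h0 on a single ray.\<close>

lemma potential_radial:
  fixes h :: "real^3 \<Rightarrow> real"
  defines "e \<equiv> axis 1 (1::real) :: real^3"
  assumes sol: "positive_radial_solution h u" and x: "x \<in> B"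
  shows "h x = h (norm x *\<^sub>R e)"
proof (cases "x = 0")
  case False
  have e: "e \<in> Basis" "norm e = 1" by (auto simp: e_def axis_in_Basis_iff)
  have U: "((\<lambda>s. u (s *\<^sub>R e)) has_real_derivative partial_deriv e u (t *\<^sub>R e)) (at t)"
    "((\<lambda>s. partial_deriv e u (s *\<^sub>R e)) has_real_derivative partial_deriv e (partial_deriv e u) (t *\<^sub>R e)) (at t)"
    if "0 < t" "t < 1" for t
    using sol that e
    by (auto intro!: DERIV_partial_line simp: positive_radial_solution_def C2_on_def C1_on_def)
  have u_eq: "u y = u (norm y *\<^sub>R e)" if "y \<in> B" for y
    using sol that e by (intro radial_onD[of B u]) (auto simp: positive_radial_solution_def)
  note L = laplacian_radial[of 1 u, OF u_eq U]
  have y: "norm x *\<^sub>R e \<in> B" "norm x *\<^sub>R e \<noteq> 0" using x e False by auto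
  have "laplacian u x = laplacian u (norm x *\<^sub>R e)"
    using L[OF _ _ _ _ _ x False] L[OF _ _ _ _ _ y] e by simp
  moreover have "laplacian u z + h z * u z = u z ^ 5" "0 < u z" if "z \<in> B" for z
    using sol that by (auto simp: positive_radial_solution_def)
  ultimately have "h x * u x = h (norm x *\<^sub>R e) * u x" "0 < u x"
    using x y(1) u_eq[OF x] by (smt (verit))+
  then show ?thesis by simp
qed simp

theorem theorem3:
  fixes h\<^sub>0 :: "real^3 \<Rightarrow> real"
  assumes "C1_on_closure B h\<^sub>0"
    and "radial_on B h\<^sub>0"
    and "\<forall>x\<in>B. h\<^sub>0 x + 1 / 2 * (x \<bullet> gradient h\<^sub>0 x) \<ge> 0"
  shows "\<forall>p>3. \<exists>\<delta>>0. \<forall>\<eta> h. 0 < \<eta> \<and> \<eta> \<le> 1 \<and> holder_on \<eta> B h \<and>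
           Lp_norm_on p B (\<lambda>x. h x - h\<^sub>0 x) \<le> \<delta> \<longrightarrow>
           \<not> (\<exists>u. positive_radial_solution h u)"
proof (intro allI impI)
  fix p :: real assume p: "3 < p"
  have h0c: "continuous_on (closure B) h\<^sub>0" and C1: "C1_on B h\<^sub>0"
    using assms(1) by (auto simp: C1_on_closure_def)
  have "bounded (h\<^sub>0 ` closure B)"
    by (intro compact_imp_bounded compact_continuous_image h0c) simp
  then obtain m where m: "\<And>x. x \<in> closure B \<Longrightarrow> \<bar>h\<^sub>0 x\<bar> \<le> m"
    by (auto simp: bounded_iff simp del: closure_ball)
  have m0: "0 \<le> m" using m[of 0] by simp
  define \<kappa> where "\<kappa> = 1 / (40 * exp (2 * (m + 1)))"
  have "1 \<le> exp (2 * (m + 1))" using m0 by simp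
  then have "1 \<le> 40 * exp (2 * (m + 1))" by linarith
  then have \<kappa>: "0 < \<kappa>" "\<kappa> \<le> 1" "40 * exp (2 * (m + 1)) * \<kappa> \<le> 1"
    by (auto simp: \<kappa>_def)
  \<comment> \<open>The area of the unit sphere, that is, the constant of polar coordinates in
    dimension 3.\<close>
  define c where "c = unit_ball_vol (3::real) * 3"
  have c: "0 < c" by (simp add: c_def)
  \<comment> \<open>The smallness budget \<kappa> is halved: this \<epsilon> makes the first term of
    \<open>integral_abs_le_weighted_powr\<close> equal to \<kappa> / 2, and \<open>I0\<close> below
    makes the bound for the second one equal to \<kappa> / 2. Both depend only on the bound
    \<open>m\<close> for \<open>h\<^sub>0\<close> and on p.\<close>
  define \<epsilon> where "\<epsilon> = \<kappa> / 2 * ((p - 3) / (p - 1))"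
  have \<epsilon>: "0 < \<epsilon>" using \<kappa> p by (simp add: \<epsilon>_def)
  define I0 where "I0 = \<kappa> / 2 * c * \<epsilon> powr (p - 1)"
  define \<delta> where "\<delta> = I0 powr (1 / p)"
  have I0: "0 < I0" using \<kappa> c \<epsilon> by (simp add: I0_def)
  show "\<exists>\<delta>>0. \<forall>\<eta> h. 0 < \<eta> \<and> \<eta> \<le> 1 \<and> holder_on \<eta> B h \<and>
           Lp_norm_on p B (\<lambda>x. h x - h\<^sub>0 x) \<le> \<delta> \<longrightarrow>
           \<not> (\<exists>u. positive_radial_solution h u)"
  proof (intro exI[of _ \<delta>] conjI allI impI notI)
    show "0 < \<delta>" using I0 by (simp add: \<delta>_def)
    fix \<eta> h
    assume A: "0 < \<eta> \<and> \<eta> \<le> 1 \<and> holder_on \<eta> B h \<and> Lp_norm_on p B (\<lambda>x. h x - h\<^sub>0 x) \<le> \<delta>"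
      and "\<exists>u. positive_radial_solution h u"
    then obtain u where sol: "positive_radial_solution h u" by blast
    have hc: "continuous_on B h" using A holder_on_imp_continuous_on by blast
    obtain C where C: "\<And>x. x \<in> B \<Longrightarrow> \<bar>h x\<bar> \<le> C"
      using A unfolding holder_on_def bounded_iff by force
    define e :: "real^3" where "e = axis 1 1"
    have e: "norm e = 1" by (simp add: e_def)
    define k where "k x = \<bar>h x - h\<^sub>0 x\<bar> powr p" for x
    define K where "K r = h (r *\<^sub>R e) - h\<^sub>0 (r *\<^sub>R e)" for r
    have h0B: "continuous_on B h\<^sub>0" using h0c closure_subset by (rule continuous_on_subset)
    have K_cont: "continuous_on {a..b} K" if "0 < a" "b < 1" for a b
      unfolding K_def using that e
      by (intro continuous_intros continuous_on_compose2[OF hc] continuous_on_compose2[OF h0B]) auto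
    have k_eq: "k x = \<bar>K (norm x)\<bar> powr p" if x: "x \<in> B" for x
    proof -
      have "h\<^sub>0 x = h\<^sub>0 (norm x *\<^sub>R e)"
        using assms(2) x e by (intro radial_onD[of B "h\<^sub>0"]) auto
      moreover have "h x = h (norm x *\<^sub>R e)"
        unfolding e_def using potential_radial[OF sol x] .
      ultimately show ?thesis by (simp add: k_def K_def)
    qed
    have k_ge: "0 \<le> k x" for x by (simp add: k_def)
    have "k x \<le> (C + m) powr p" if "x \<in> B" for x
      unfolding k_def using C[OF that] m[of x] that closure_subset[of B] p
      by (intro powr_mono2) auto
    moreover have "continuous_on B k"
      unfolding k_def using p by (intro continuous_on_powr' continuous_on_rabs continuous_on_diff hc h0B) auto
    \<comment> \<open>Integrability ensures that the integral inside \<open>Lp_norm_on\<close> is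
      genuine and not the default value 0.\<close>
    ultimately have k_int: "set_integrable lborel B k"
      by (intro set_integrable_bounded_continuous[where C = "(C + m) powr p"]) (auto simp: k_ge)
    define I where "I = (LINT x:B|lborel. k x)"
    have I_nonneg: "0 \<le> I"
      unfolding I_def set_lebesgue_integral_def by (intro integral_nonneg_AE) (auto simp: k_def)
    have "I powr (1 / p) \<le> I0 powr (1 / p)"
      using A by (simp add: Lp_norm_on_def I_def k_def \<delta>_def)
    then have I_le: "I \<le> I0"
      using p I0 I_nonneg powr_less_mono2[of "1 / p" I0 I] by fastforce
    have small: "integral {a..b} (\<lambda>r. \<bar>K r\<bar>) \<le> \<kappa>" if ab: "0 < a" "a \<le> b" "b < 1" for a b
    proof -
      have "c * integral {a..b} (\<lambda>r. r\<^sup>2 * \<bar>K r\<bar> powr p) \<le> I"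
      proof -
        have "continuous_on {a..b} (\<lambda>r. \<bar>K r\<bar> powr p)"
          using p ab by (intro continuous_on_powr' continuous_on_rabs K_cont) auto
        then show ?thesis
          using radial_weighted_integral_le[OF k_int, of a b "\<lambda>r. \<bar>K r\<bar> powr p"] k_eq ab
          by (simp add: I_def c_def k_ge)
      qed
      then have "integral {a..b} (\<lambda>r. r\<^sup>2 * \<bar>K r\<bar> powr p) \<le> I0 / c"
        using I_le c by (simp add: field_simps)
      then have "\<epsilon> powr (1 - p) * integral {a..b} (\<lambda>r. r\<^sup>2 * \<bar>K r\<bar> powr p) \<le> \<epsilon> powr (1 - p) * (I0 / c)"
        by (intro mult_left_mono) auto
      also have "\<dots> = \<kappa> / 2 * (\<epsilon> powr (1 - p) * \<epsilon> powr (p - 1))"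
        using c by (simp add: I0_def)
      also have "\<dots> = \<kappa> / 2"
        using \<epsilon> by (simp flip: powr_add)
      finally have "\<epsilon> powr (1 - p) * integral {a..b} (\<lambda>r. r\<^sup>2 * \<bar>K r\<bar> powr p) \<le> \<kappa> / 2" .
      moreover have "\<epsilon> * ((p - 1) / (p - 3)) = \<kappa> / 2"
        using p by (simp add: \<epsilon>_def divide_simps)
      ultimately show ?thesis
        using integral_abs_le_weighted_powr[OF K_cont[of a b] ab(1,2) _ p \<epsilon>] ab by simp
    qed
    have "\<bar>h\<^sub>0 x\<bar> \<le> m" if "x \<in> B" for x
      using m closure_subset that by blast
    from no_positive_radial_solution_of_integral_le[OF C1 assms(3) this hc small[unfolded K_def e_def] \<kappa>(2,3)] sol
    show False by blast
  qed
qed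

end
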